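(* Every graph $G$ is local antimagic total, i.e. admits a local antimagic total labeling.
   Context: Graphs are finite and simple. For a graph $G=(V,E)$ of order $p=|V|$ and size $q=|E|$, a local antimagic total labeling of $G$ is a bijection $f:V(G)\cup E(G)\to\{1,2,\ldots,p+q\}$ such that $w_f(u)\neq w_f(v)$ for every pair of adjacent vertices $u,v$, where the weight of a vertex $u$ is $w_f(u)=f(u)+\sum_{uv\in E(G)}f(uv)$. $G$ is called local antimagic total if it admits a local antimagic total labeling. *)

theory Defs
  imports Main
begin

text \<open>An edge is the two-element set of its end points, so graphs have neither loops nor
  multiple edges. The graph with no vertices is admitted.\<close>

definition finite_simple_graph :: "'a set \<Rightarrow> 'a set set \<Rightarrow> bool" where
  "finite_simple_graph V E \<longleftrightarrow> finite V \<and> (\<forall>e\<in>E. e \<subseteq> V \<and> card e = 2)"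

text \<open>A total labeling lives on the disjoint union of vertices and edges: \<open>f (Inl v)\<close> is the
  label of the vertex \<open>v\<close>, and \<open>f (Inr e)\<close> the label of the edge \<open>e\<close>.\<close>

definition weight :: "'a set set \<Rightarrow> ('a + 'a set \<Rightarrow> nat) \<Rightarrow> 'a \<Rightarrow> nat" where
  "weight E f u = f (Inl u) + (\<Sum>e | e \<in> E \<and> u \<in> e. f (Inr e))"

definition local_antimagic_total_labeling ::
    "'a set \<Rightarrow> 'a set set \<Rightarrow> ('a + 'a set \<Rightarrow> nat) \<Rightarrow> bool" where
  "local_antimagic_total_labeling V E f \<longleftrightarrow>
     bij_betw f (V <+> E) {1..card V + card E} \<and>
     (\<forall>u\<in>V. \<forall>v\<in>V. {u, v} \<in> E \<longrightarrow> weight E f u \<noteq> weight E f v)"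

definition local_antimagic_total :: "'a set \<Rightarrow> 'a set set \<Rightarrow> bool" where
  "local_antimagic_total V E \<longleftrightarrow> (\<exists>f. local_antimagic_total_labeling V E f)"

end

theory Submission
  imports Defs
begin

text \<open>Give the edges the labels \<open>1, \<dots>, q\<close> in any way. This fixes the contribution \<open>s u\<close> of the
  incident edges to the weight of each vertex \<open>u\<close>. Now hand out the remaining labels
  \<open>q + 1, \<dots>, q + p\<close> to the vertices in the order of increasing \<open>s\<close>, ties being broken
  arbitrarily (\<open>ex_bij_betw_respecting\<close>). Along this order \<open>s\<close> does not decrease and the vertex label
  strictly increases, so the weight, which is their sum, strictly increases. Hence all
  vertices, adjacent or not, get different weights. That adjacent vertices are distinct, because an
  edge has two elements, turns this into the local property.\<close>

text \<open>Sorting a finite set by the key \<open>s\<close> and numbering it in this order: by induction, an element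
  of largest key comes last.\<close>

lemma ex_bij_betw_respecting:
  fixes s :: "'a \<Rightarrow> 'b::linorder"
  assumes "finite A"
  shows "\<exists>g. bij_betw g A {1..card A} \<and> (\<forall>u\<in>A. \<forall>v\<in>A. g u < g v \<longrightarrow> s u \<le> s v)"
  using assms
proof (induction A rule: finite_ranking_induct[where f = s])
  case empty
  show ?case by (simp add: bij_betw_def)
next
  case (insert x S)
  show ?case
  proof (cases "x \<in> S")
    case True
    then show ?thesis using insert.IH by (simp add: insert_absorb)
  next
    \<comment> \<open>Number \<open>S\<close> by the induction hypothesis and give \<open>x\<close>, whose key is largest, the next number.\<close>
    case False
    from insert.IH obtain g where bij: "bij_betw g S {1..card S}"
      and mono: "\<forall>u\<in>S. \<forall>v\<in>S. g u < g v \<longrightarrow> s u \<le> s v" by blast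
    define h where "h = g(x := Suc (card S))"
    have h_S: "h u = g u" if "u \<in> S" for u
      using that False by (auto simp: h_def)
    have h_x: "h x = Suc (card S)" by (simp add: h_def)
    have "bij_betw h S {1..card S}"
      using bij h_S by (simp cong: bij_betw_cong)
    then have "bij_betw h (S \<union> {x}) ({1..card S} \<union> {h x})"
      using False h_x by (intro notIn_Un_bij_betw) simp_all
    then have "bij_betw h (insert x S) {1..card (insert x S)}"
      using False insert.hyps by (simp add: h_x atLeastAtMostSuc_conv)
    moreover have "s u \<le> s v" if "u \<in> insert x S" "v \<in> insert x S" "h u < h v" for u v
    proof -
      have "g w \<le> card S" if "w \<in> S" for w
        using bij_betwE[OF bij] that by auto
      with that have "u \<in> S" using h_S h_x by fastforce
      then show ?thesis using that insert.hyps mono h_S by auto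
    qed
    ultimately show ?thesis by blast
  qed
qed

text \<open>Asking for distinct weights at all vertices leaves only a question of sorting: adding strictly
  increasing vertex labels to a sorted sequence of edge sums removes every repetition. The
  numbering \<open>g\<close> of the vertices by edge sum is shifted by \<open>q\<close> to make room for the edge labels,
  which alters all weights alike.\<close>

lemma ex_antimagic_total_labeling:
  assumes "finite V" and "finite E"
  shows "\<exists>f. bij_betw f (V <+> E) {1..card V + card E} \<and> inj_on (weight E f) V"
proof -
  obtain h where h: "bij_betw h E {1..card E}"
    using finite_same_card_bij[OF \<open>finite E\<close>, of "{1..card E}"] by auto
  define s where "s u = (\<Sum>e | e \<in> E \<and> u \<in> e. h e)" for u
  obtain g where g: "bij_betw g V {1..card V}"
    and mono: "\<And>u v. u \<in> V \<Longrightarrow> v \<in> V \<Longrightarrow> g u < g v \<Longrightarrow> s u \<le> s v"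
    using ex_bij_betw_respecting[OF \<open>finite V\<close>, of s] by blast
  define f where "f = case_sum (\<lambda>v. card E + g v) h"
  have "bij_betw ((+) (card E)) {1..card V} {card E + 1..card E + card V}"
    by (simp add: bij_betw_def)
  then have "bij_betw (\<lambda>v. card E + g v) V {card E + 1..card E + card V}"
    using bij_betw_trans[OF g] unfolding comp_def by blast
  then have "bij_betw (f \<circ> Inl) V {card E + 1..card E + card V}"
    by (simp add: f_def comp_def)
  then have "bij_betw f (Inl ` V) {card E + 1..card E + card V}"
    by (simp add: bij_betw_def inj_on_def image_comp)
  moreover have "bij_betw f (Inr ` E) {1..card E}"
    using h by (simp add: f_def bij_betw_def inj_on_def image_image)
  ultimately have "bij_betw f (Inl ` V \<union> Inr ` E) ({card E + 1..card E + card V} \<union> {1..card E})"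
    by (rule bij_betw_combine) auto
  moreover have "{card E + 1..card E + card V} \<union> {1..card E} = {1..card V + card E}"
    by auto
  ultimately have "bij_betw f (V <+> E) {1..card V + card E}"
    by (simp add: Plus_def)
  moreover have "inj_on (weight E f) V"
  proof (rule inj_onI)
    fix u v
    assume uv: "u \<in> V" "v \<in> V" and "weight E f u = weight E f v"
    then have eq: "g u + s u = g v + s v"
      by (simp add: weight_def f_def s_def)
    have "g u = g v"
      using mono[OF uv] mono[OF uv(2,1)] eq by linarith
    then show "u = v"
      using g uv by (auto simp: bij_betw_def dest: inj_onD)
  qed
  ultimately show ?thesis by blast
qed

theorem theorem2p1:
  fixes V :: "'a set" and E :: "'a set set"
  assumes "finite_simple_graph V E"
  shows "local_antimagic_total V E"
proof -
  have "finite V" and edges: "\<And>e. e \<in> E \<Longrightarrow> e \<subseteq> V \<and> card e = 2"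
    using assms by (auto simp: finite_simple_graph_def)
  moreover from this have "finite E"
    by (meson Pow_iff finite_Pow_iff finite_subset subsetI)
  ultimately obtain f where "bij_betw f (V <+> E) {1..card V + card E}"
    and inj: "inj_on (weight E f) V"
    using ex_antimagic_total_labeling by blast
  moreover have "weight E f u \<noteq> weight E f v" if "u \<in> V" "v \<in> V" "{u, v} \<in> E" for u v
  proof -
    have "u \<noteq> v" using edges[OF that(3)] by auto
    then show ?thesis using inj that by (auto dest: inj_onD)
  qed
  ultimately show ?thesis
    by (auto simp: local_antimagic_total_def local_antimagic_total_labeling_def)
qed

end
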